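(* Let $K\ge1$ and $\mu\ge0$. Suppose that $f(z)=h(z)+\overline{g(z)}=\sum_{n=0}^\infty a_nz^n+\overline{\sum_{n=1}^\infty b_nz^n}$ is a sense-preserving $K$-quasiconformal harmonic mapping in $\mathbb{D}$ and $h\prec\phi$, where $\phi$ is univalent and convex in $\mathbb{D}$. Then $$\sum_{n=1}^\infty\left(|a_n|+|b_n|\right)r^n+\mu\left(\frac{S_r(h)}{\pi}\right)^{1/2}\le d(\phi(0),\partial\phi(\mathbb{D}))\quad\text{for } r\le r_0,$$ where $r_0\in(0,1)$ is the unique positive root of the equation $$\left(\frac{5K+1}{K+1}\right)r^2+2\left(\mu+\frac{2K}{K+1}\right)r-1=0.$$ The number $r_0$ is sharp: for given $K$ and $\mu$ it cannot be replaced by any larger number for which the inequality holds for all such $f$ and $\phi$.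
   Context: $\mathbb{D}=\{z\in\mathbb{C}:|z|<1\}$, $\mathbb{D}_r=\{z\in\mathbb{C}:|z|<r\}$, and $r=|z|\in[0,1)$. A harmonic mapping in $\mathbb{D}$ is written $f=h+\overline{g}$ with $h,g$ analytic in $\mathbb{D}$. It is locally univalent and sense-preserving if $h'\neq0$ in $\mathbb{D}$ and the dilatation $\omega=g'/h'$ satisfies $|\omega|<1$ in $\mathbb{D}$. Such an $f$ is called $K$-quasiconformal for $K\ge1$ if $|\omega(z)|\le k<1$ for all $z\in\mathbb{D}$, where $K=(1+k)/(1-k)$, i.e. $k=(K-1)/(K+1)$. For analytic $h,\phi$ in $\mathbb{D}$, $h\prec\phi$ (subordination) means $h=\phi\circ w$ for some analytic $w:\mathbb{D}\to\mathbb{D}$ with $w(0)=0$. "Univalent and convex" means $\phi$ is analytic and injective on $\mathbb{D}$ and $\phi(\mathbb{D})$ is a convex domain. $d(\phi(0),\partial\phi(\mathbb{D}))$ is the Euclidean distance from $\phi(0)$ to the boundary of $\phi(\mathbb{D})$. $S_r(h)=\int_{\mathbb{D}_r}|h'(z)|^2\,dA(z)$ with $dA$ planar Lebesgue measure, so that $S_r(h)/\pi=\sum_{n=1}^\infty n|a_n|^2r^{2n}$. *)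

theory Defs
  imports "HOL-Complex_Analysis.Complex_Analysis"
begin

definition harmonic_decomposition ::
    "(complex \<Rightarrow> complex) \<Rightarrow> (complex \<Rightarrow> complex) \<Rightarrow> (complex \<Rightarrow> complex) \<Rightarrow> bool" where
  "harmonic_decomposition f h g \<longleftrightarrow>
     h holomorphic_on ball 0 1 \<and> g holomorphic_on ball 0 1 \<and>
     (\<forall>z\<in>ball 0 1. f z = h z + cnj (g z))"

definition dilatation :: "(complex \<Rightarrow> complex) \<Rightarrow> (complex \<Rightarrow> complex) \<Rightarrow> complex \<Rightarrow> complex" where
  "dilatation h g z = deriv g z / deriv h z"

definition sense_preserving :: "(complex \<Rightarrow> complex) \<Rightarrow> (complex \<Rightarrow> complex) \<Rightarrow> bool" where
  "sense_preserving h g \<longleftrightarrow>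
     (\<forall>z\<in>ball 0 1. deriv h z \<noteq> 0 \<and> cmod (dilatation h g z) < 1)"

(* The harmonic mapping f enters through its decomposition f = h + cnj g, so that the
   sense-preserving and quasiconformal conditions can refer to h and g. *)
definition quasiconformal_harmonic ::
    "real \<Rightarrow> (complex \<Rightarrow> complex) \<Rightarrow> (complex \<Rightarrow> complex) \<Rightarrow> (complex \<Rightarrow> complex) \<Rightarrow> bool" where
  "quasiconformal_harmonic K f h g \<longleftrightarrow>
     harmonic_decomposition f h g \<and> sense_preserving h g \<and>
     (\<forall>z\<in>ball 0 1. cmod (dilatation h g z) \<le> (K - 1) / (K + 1))"

definition subordinate :: "(complex \<Rightarrow> complex) \<Rightarrow> (complex \<Rightarrow> complex) \<Rightarrow> bool" where
  "subordinate h \<phi> \<longleftrightarrow>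
     (\<exists>w. w holomorphic_on ball 0 1 \<and> w \<in> ball 0 1 \<rightarrow> ball 0 1 \<and> w 0 = 0 \<and>
          (\<forall>z\<in>ball 0 1. h z = \<phi> (w z)))"

definition univalent_convex :: "(complex \<Rightarrow> complex) \<Rightarrow> bool" where
  "univalent_convex \<phi> \<longleftrightarrow>
     \<phi> holomorphic_on ball 0 1 \<and> inj_on \<phi> (ball 0 1) \<and> convex (\<phi> ` ball 0 1)"

definition area_integral :: "(complex \<Rightarrow> complex) \<Rightarrow> real \<Rightarrow> real" where
  "area_integral h r = (LINT z:ball 0 r|lborel. (cmod (deriv h z))\<^sup>2)"

(* The inequality for every admissible f and phi and all radii r = |z| up to \<rho>.
   The series of g starts at n = 1, which normalises g 0 = 0; the value b 0 is never used.
   The boundary of \<phi> ` ball 0 1 is nonempty because an injective holomorphic \<phi> is not onto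
   the plane, so the infimum distance is the genuine one. *)
definition bohr_inequality_upto :: "real \<Rightarrow> real \<Rightarrow> real \<Rightarrow> bool" where
  "bohr_inequality_upto K \<mu> \<rho> \<longleftrightarrow>
     (\<forall>f h g \<phi> a b r.
        quasiconformal_harmonic K f h g \<longrightarrow>
        (\<forall>z\<in>ball 0 1. (\<lambda>n. a n * z ^ n) sums h z) \<longrightarrow>
        (\<forall>z\<in>ball 0 1. (\<lambda>n. b (Suc n) * z ^ Suc n) sums g z) \<longrightarrow>
        univalent_convex \<phi> \<longrightarrow> subordinate h \<phi> \<longrightarrow>
        0 \<le> r \<longrightarrow> r < 1 \<longrightarrow> r \<le> \<rho> \<longrightarrow>
        (\<Sum>n. (cmod (a (Suc n)) + cmod (b (Suc n))) * r ^ Suc n)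
          + \<mu> * sqrt (area_integral h r / pi)
        \<le> infdist (\<phi> 0) (frontier (\<phi> ` ball 0 1)))"

end

theory Submission imports Defs begin

text \<open>
  A convex domain lies on one side of a supporting line through the boundary point nearest to
  \<open>\<phi> 0\<close>, so Caratheodory's coefficient estimate for functions into a half-plane gives
  \<open>|a\<^sub>n| \<le> 2 d\<close> for \<open>n \<ge> 1\<close>, where \<open>d\<close> is the distance from \<open>\<phi> 0\<close> to the boundary.
  From \<open>g' = \<omega> h'\<close> with \<open>|\<omega>| \<le> k\<close> and Bohr's inequality for \<open>\<omega>\<close>, the majorant series of
  \<open>g\<close> is at most \<open>k\<close> times that of \<open>h\<close> for \<open>r \<le> 1/3\<close>, and \<open>r\<^sub>0 \<le> 1/3\<close>. Summing geometric
  series turns the claim into \<open>2 (1 + k) r / (1 - r) + 2 \<mu> r / (1 - r\<^sup>2) \<le> 1\<close>, which is the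
  quadratic inequality. All estimates are equalities for \<open>h z = \<phi> z = 1 / (1 - z)\<close> and
  \<open>g = k (h - 1)\<close>, where the image of \<open>\<phi>\<close> is a half-plane.
\<close>

section \<open>Coefficient estimates\<close>

lemma power_series_deriv:
  fixes a :: "nat \<Rightarrow> complex"
  assumes "\<And>z. z \<in> ball 0 1 \<Longrightarrow> (\<lambda>n. a n * z ^ n) sums f z" and "z \<in> ball 0 1"
  shows "(\<lambda>n. of_nat (Suc n) * a (Suc n) * z ^ n) sums deriv f z"
proof -
  have "f holomorphic_on ball 0 1"
    using assms(1) by (intro power_series_holomorphic[where a=a]) auto
  then have "(f has_field_derivative deriv f z) (at z)"
    using assms(2) by (intro holomorphic_derivI) auto
  then have "(\<lambda>n. diffs a n * z ^ n) sums deriv f z"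
    using assms by (intro termdiffs_sums_strong[where K=1 and f=f]) auto
  then show ?thesis by (simp add: diffs_def)
qed

text \<open>The difference series represents 0. A nonzero coefficient of positive index would make
  its zero at the origin isolated; index 0 is settled by evaluating both series at the
  origin.\<close>

lemma power_series_unique:
  fixes a b :: "nat \<Rightarrow> complex"
  assumes a: "\<And>z. z \<in> ball 0 1 \<Longrightarrow> (\<lambda>n. a n * z ^ n) sums f z"
    and b: "\<And>z. z \<in> ball 0 1 \<Longrightarrow> (\<lambda>n. b n * z ^ n) sums f z"
  shows "a n = b n"
proof (rule ccontr)
  assume ne: "a n \<noteq> b n"
  have s: "(\<lambda>n. (a n - b n) * z ^ n) sums 0" if "z \<in> ball 0 1" for z
    using sums_diff[OF a b, OF that that] by (simp add: algebra_simps)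
  have "a 0 = b 0"
    using a[of 0] b[of 0] by simp
  with ne have "0 < n" by (cases n) auto
  show False
  proof (rule powser_0_nonzero[of 1 0 "\<lambda>n. a n - b n" "\<lambda>z. 0" n])
    fix s :: real assume "0 < s" "\<And>z. z \<in> cball (0::complex) s - {0} \<Longrightarrow> (0::complex) \<noteq> 0"
    from this(2)[of "of_real s"] this(1) show False by auto
  qed (use s ne \<open>0 < n\<close> in auto)
qed

lemma power_series_norm_summable:
  fixes a :: "nat \<Rightarrow> complex"
  assumes "\<And>z. z \<in> ball 0 1 \<Longrightarrow> (\<lambda>n. a n * z ^ n) sums f z" and "0 \<le> r" "r < 1"
  shows "summable (\<lambda>n. cmod (a n) * r ^ n)"
proof -
  \<comment> \<open>Convergence at a point of modulus strictly between \<open>r\<close> and 1 forces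
    absolute convergence at \<open>r\<close>.\<close>
  obtain s where s: "r < s" "s < 1" using dense[OF assms(3)] by auto
  have "summable (\<lambda>n. a n * of_real s ^ n)"
    using assms s by (intro sums_summable[OF assms(1)]) auto
  then have "summable (\<lambda>n. norm (a n * of_real r ^ n))"
    by (rule powser_insidea) (use assms s in auto)
  then show ?thesis using assms by (simp add: norm_mult norm_power)
qed

section \<open>Functions with nonnegative real part\<close>

text \<open>The Cayley transform \<open>F\<close> of a shifted copy \<open>p\<close> of
  \<open>f\<close>, normalised to vanish at 0, maps the disc into itself, and the Schwarz lemma
  bounds its derivative there. The shift by \<open>e / 2\<close> makes the real part strictly
  positive, so that the denominator of \<open>F\<close> has no zeros; it disappears as
  \<open>e\<close> tends to 0.\<close>

lemma Caratheodory_first_coeff: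
  assumes holo: "f holomorphic_on ball 0 1" and pos: "\<And>z. z \<in> ball 0 1 \<Longrightarrow> 0 \<le> Re (f z)"
  shows "cmod (deriv f 0) \<le> 2 * Re (f 0)"
proof (rule field_le_epsilon)
  fix e :: real assume "0 < e"
  define p where "p z = f z + of_real (e/2)" for z
  have posp: "0 < Re (p z)" if "z \<in> ball 0 1" for z
    using pos[OF that] \<open>0 < e\<close> by (simp add: p_def)
  have hp: "p holomorphic_on ball 0 1"
    unfolding p_def by (intro holomorphic_intros holo)
  have nz: "p z + cnj (p 0) \<noteq> 0" if "z \<in> ball 0 1" for z
  proof
    assume "p z + cnj (p 0) = 0"
    then have "Re (p z + cnj (p 0)) = 0" by simp
    with posp[OF that] posp[of 0] show False by simp
  qed
  define F where "F z = (p z - p 0) / (p z + cnj (p 0))" for z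
  have hF: "F holomorphic_on ball 0 1"
    unfolding F_def by (intro holomorphic_intros hp) (use nz in auto)
  have lt: "cmod (F z) < 1" if "cmod z < 1" for z
  proof -
    have z: "z \<in> ball 0 1" using that by simp
    have "0 < Re (p z) * Re (p 0)" using posp[OF z] posp[of 0] by simp
    \<comment> \<open>The two squares differ by \<open>4 * Re (p z) * Re (p 0)\<close>.\<close>
    then have "(cmod (p z - p 0))\<^sup>2 < (cmod (p z + cnj (p 0)))\<^sup>2"
      by (simp only: cmod_power2) (simp add: power2_eq_square algebra_simps)
    then have "cmod (p z - p 0) < cmod (p z + cnj (p 0))"
      by (simp add: power_less_imp_less_base)
    then show ?thesis using nz[OF z] by (simp add: F_def norm_divide)
  qed
  have "cmod (deriv F 0) \<le> 1"
    by (rule Schwarz_Lemma(2)[of F 0]) (use hF lt in \<open>auto simp: F_def\<close>)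
  have "(f has_field_derivative deriv f 0) (at 0)"
    using holo by (intro holomorphic_derivI) auto
  then have dp: "(p has_field_derivative deriv f 0) (at 0)"
    unfolding p_def by (auto intro!: derivative_eq_intros)
  have "(F has_field_derivative deriv f 0 / (p 0 + cnj (p 0))) (at 0)"
    unfolding F_def using nz[of 0] by (auto intro!: derivative_eq_intros dp)
  then have "deriv F 0 = deriv f 0 / (p 0 + cnj (p 0))" by (rule DERIV_imp_deriv)
  also have "p 0 + cnj (p 0) = of_real (2 * Re (p 0))" by (simp add: complex_eq_iff)
  finally have "cmod (deriv f 0) = cmod (deriv F 0) * (2 * Re (p 0))"
    using posp[of 0] by (simp add: norm_divide)
  also have "\<dots> \<le> 2 * Re (p 0)"
    using \<open>cmod (deriv F 0) \<le> 1\<close> posp[of 0] by (simp add: mult_left_le_one_le)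
  finally show "cmod (deriv f 0) \<le> 2 * Re (f 0) + e" by (simp add: p_def)
qed

text \<open>This is a geometric sum whose ratio \<open>c\<close> satisfies \<open>c ^ n = 1\<close>:
  it vanishes unless \<open>c = 1\<close>, that is, unless \<open>n\<close> divides
  \<open>m\<close>.\<close>

lemma sum_powers_root_of_unity:
  assumes "0 < n"
  shows "(\<Sum>j<n. cis (2 * pi * real j / real n) ^ m) = (if n dvd m then of_nat n else 0)"
proof -
  define c where "c = cis (2 * pi / real n) ^ m"
  have eq: "cis (2 * pi * real j / real n) ^ m = c ^ j" for j
    by (simp add: c_def Complex.DeMoivre power_mult [symmetric] mult_ac)
  have c1: "c = 1 \<longleftrightarrow> n dvd m"
  proof -
    have "c = exp (2 * of_real pi * \<i> * of_nat m / of_nat n)"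
      by (simp add: c_def cis_conv_exp mult_ac flip: exp_of_nat_mult)
    then show ?thesis using complex_root_unity_eq_1[of n m] assms by simp
  qed
  have "c ^ n = 1"
    using assms cis_multiple_2pi[of "real m"] by (simp add: c_def Complex.DeMoivre mult_ac flip: power_mult)
  then show ?thesis
    using c1 by (auto simp: eq sum_gp_strict assms)
qed

text \<open>Averaging over the rotations by \<open>n\<close>-th roots of unity keeps only the terms with exponent
  divisible by \<open>n\<close>, which reduces the \<open>n\<close>-th coefficient to the first one.\<close>

lemma Caratheodory_coeff:
  assumes sums: "\<And>z. z \<in> ball 0 1 \<Longrightarrow> (\<lambda>n. a n * z ^ n) sums f z"
    and pos: "\<And>z. z \<in> ball 0 1 \<Longrightarrow> 0 \<le> Re (f z)" and n: "0 < n"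
  shows "cmod (a n) \<le> 2 * Re (a 0)"
proof -
  define \<zeta> where "\<zeta> j = cis (2 * pi * real j / real n)" for j
  define G where "G w = (\<Sum>k. a (n * k) * w ^ k)" for w
  have ave: "(\<lambda>k. a (n * k) * (z ^ n) ^ k) sums ((\<Sum>j<n. f (\<zeta> j * z)) / of_nat n)"
    if "z \<in> ball 0 1" for z
  proof -
    have "(\<lambda>m. \<Sum>j<n. a m * (\<zeta> j * z) ^ m) sums (\<Sum>j<n. f (\<zeta> j * z))"
      by (intro sums_sum sums) (use that in \<open>simp add: \<zeta>_def norm_mult\<close>)
    then have "(\<lambda>m. (\<Sum>j<n. a m * (\<zeta> j * z) ^ m) / of_nat n) sums ((\<Sum>j<n. f (\<zeta> j * z)) / of_nat n)"
      by (rule sums_divide)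
    also have "(\<lambda>m. (\<Sum>j<n. a m * (\<zeta> j * z) ^ m) / of_nat n) = (\<lambda>m. if n dvd m then a m * z ^ m else 0)"
    proof
      fix m
      have "(\<Sum>j<n. a m * (\<zeta> j * z) ^ m) = a m * z ^ m * (\<Sum>j<n. \<zeta> j ^ m)"
        by (simp add: power_mult_distrib sum_distrib_left mult_ac)
      then show "(\<Sum>j<n. a m * (\<zeta> j * z) ^ m) / of_nat n = (if n dvd m then a m * z ^ m else 0)"
        using n sum_powers_root_of_unity[OF n, of m] by (simp add: \<zeta>_def)
    qed
    finally have "(\<lambda>m. if n dvd m then a m * z ^ m else 0) sums ((\<Sum>j<n. f (\<zeta> j * z)) / of_nat n)" .
    \<comment> \<open>Reindexing along the multiples of \<open>n\<close> loses nothing, since all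
      other terms are zero.\<close>
    then have "(\<lambda>k. if n dvd n * k then a (n * k) * z ^ (n * k) else 0) sums ((\<Sum>j<n. f (\<zeta> j * z)) / of_nat n)"
      by (subst sums_mono_reindex[where g="\<lambda>k. n * k"]) (use n in \<open>auto simp: strict_mono_def\<close>)
    then show ?thesis by (simp add: power_mult)
  qed
  \<comment> \<open>Every point of the disc is an \<open>n\<close>-th power of a point of the disc,
    so the averages control \<open>G\<close> on the whole disc.\<close>
  have root: "\<exists>z\<in>ball 0 1. w = z ^ n" if "w \<in> ball 0 1" for w :: complex
  proof -
    obtain z where z: "z ^ n = w" using n by (metis exists_complex_root neq0_conv)
    then have "cmod z ^ n < 1" using that by (simp flip: norm_power)
    then have "cmod z < 1"
      using n by (metis linorder_not_less one_le_power)
    with z show ?thesis by (auto intro!: bexI[of _ z])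
  qed
  have G: "(\<lambda>k. a (n * k) * w ^ k) sums G w \<and> 0 \<le> Re (G w)" if w: "w \<in> ball 0 1" for w
  proof -
    obtain z where z: "z \<in> ball 0 1" "w = z ^ n" using root[OF w] by blast
    have s: "(\<lambda>k. a (n * k) * w ^ k) sums ((\<Sum>j<n. f (\<zeta> j * z)) / of_nat n)"
      using ave[OF z(1)] z(2) by simp
    then have e: "G w = (\<Sum>j<n. f (\<zeta> j * z)) / of_nat n" unfolding G_def by (rule sums_unique[symmetric])
    have "0 \<le> (\<Sum>j<n. Re (f (\<zeta> j * z)))"
      by (intro sum_nonneg pos) (use z in \<open>simp add: \<zeta>_def norm_mult\<close>)
    then have "0 \<le> Re (G w)" by (simp add: e)
    with s e show ?thesis by simp
  qed
  have "G holomorphic_on ball 0 1"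
    using G by (intro power_series_holomorphic[where a="\<lambda>k. a (n * k)"]) auto
  then have "cmod (deriv G 0) \<le> 2 * Re (G 0)"
    using G by (intro Caratheodory_first_coeff) auto
  moreover have "G 0 = a 0" using G[of 0] by simp
  moreover have "deriv G 0 = a n"
    using power_series_deriv[of "\<lambda>k. a (n * k)" G 0] G by simp
  ultimately show ?thesis by simp
qed

section \<open>Bounded functions and Bohr's inequality\<close>

text \<open>With a unimodular \<open>u\<close>, a bound on the modulus or a half-plane condition
  says that \<open>k - u * w\<close> has nonnegative real part. These are the coefficients to which
  Caratheodory's estimate is then applied.\<close>

lemma power_series_const_minus:
  fixes c :: "nat \<Rightarrow> complex"
  assumes "(\<lambda>n. c n * z ^ n) sums w"
  shows "(\<lambda>n. ((if n = 0 then k else 0) - u * c n) * z ^ n) sums (k - u * w)"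
proof -
  have "(\<lambda>n. (if n = 0 then k else 0) - u * (c n * z ^ n)) sums (k - u * w)"
    using sums_single[of 0 "\<lambda>n. k"] by (intro sums_diff sums_mult assms) auto
  also have "(\<lambda>n. (if n = 0 then k else 0) - u * (c n * z ^ n)) = (\<lambda>n. ((if n = 0 then k else 0) - u * c n) * z ^ n)"
    by (auto simp: algebra_simps)
  finally show ?thesis .
qed

text \<open>Caratheodory's estimate for \<open>k - u * w\<close>, whose constant term has real part
  \<open>k - cmod (c 0)\<close>, bounds every later coefficient by twice that number. The tail of
  the majorant series is then at most \<open>k - cmod (c 0)\<close>, which is what the constant term
  leaves free.\<close>

lemma Bohr_inequality:
  assumes sums: "\<And>z. z \<in> ball 0 1 \<Longrightarrow> (\<lambda>n. c n * z ^ n) sums w z"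
    and bound: "\<And>z. z \<in> ball 0 1 \<Longrightarrow> cmod (w z) \<le> k"
    and r: "0 \<le> r" "r \<le> 1 / 3"
  shows "(\<Sum>n. cmod (c n) * r ^ n) \<le> k"
proof -
  have c0: "cmod (c 0) \<le> k" using sums[of 0] bound[of 0] by simp
  \<comment> \<open>The rotation \<open>u\<close> makes the constant coefficient real and
    nonnegative; if \<open>c 0 = 0\<close>, any unimodular number serves.\<close>
  obtain u where u: "cmod u = 1" "u * c 0 = of_real (cmod (c 0))"
  proof (cases "c 0 = 0")
    case True then show ?thesis by (intro that[of 1]) auto
  next
    case False
    have "cnj (c 0) / cmod (c 0) * c 0 = of_real (cmod (c 0))"
      using False complex_norm_square[of "c 0"] by (simp add: divide_eq_eq power2_eq_square mult.commute)
    then show ?thesis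
      by (intro that[of "cnj (c 0) / cmod (c 0)"]) (use False in \<open>auto simp: norm_divide\<close>)
  qed
  have coeff: "cmod (c n) \<le> 2 * (k - cmod (c 0))" if "0 < n" for n
  proof -
    have "(\<lambda>n. ((if n = 0 then of_real k else 0) - u * c n) * z ^ n) sums (of_real k - u * w z)"
      if "z \<in> ball 0 1" for z
      by (rule power_series_const_minus[OF sums[OF that]])
    moreover have "0 \<le> Re (of_real k - u * w z)" if "z \<in> ball 0 1" for z
    proof -
      have "Re (u * w z) \<le> cmod (u * w z)" by (rule complex_Re_le_cmod)
      also have "\<dots> \<le> k" using bound[OF that] u by (simp add: norm_mult)
      finally show ?thesis by simp
    qed
    ultimately have "cmod ((if n = 0 then of_real k else 0) - u * c n) \<le> 2 * Re ((if (0::nat) = 0 then of_real k else 0) - u * c 0)"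
      using that by (rule Caratheodory_coeff)
    then show ?thesis using that u by (simp add: norm_mult)
  qed
  have sm: "summable (\<lambda>n. cmod (c n) * r ^ n)"
    using r by (intro power_series_norm_summable[OF sums]) auto
  have "(\<Sum>n. cmod (c (Suc n)) * r ^ Suc n) \<le> (\<Sum>n. 2 * (k - cmod (c 0)) * r * r ^ n)"
  proof (rule suminf_le)
    show "cmod (c (Suc n)) * r ^ Suc n \<le> 2 * (k - cmod (c 0)) * r * r ^ n" for n
      using mult_right_mono[OF coeff[of "Suc n"], of "r ^ Suc n"] r by (simp add: mult_ac)
    show "summable (\<lambda>n. cmod (c (Suc n)) * r ^ Suc n)"
      using sm by (rule summable_Suc_iff[THEN iffD2])
    show "summable (\<lambda>n. 2 * (k - cmod (c 0)) * r * r ^ n)"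
      using r by (intro summable_mult summable_geometric) auto
  qed
  also have "\<dots> = (k - cmod (c 0)) * (2 * r / (1 - r))"
    using r by (subst suminf_mult) (auto simp: summable_geometric suminf_geometric)
  \<comment> \<open>The radius 1/3 is exactly where \<open>2 * r / (1 - r)\<close> reaches
    1.\<close>
  also have "\<dots> \<le> (k - cmod (c 0)) * 1"
    using c0 r by (intro mult_left_mono) (auto simp: field_simps)
  finally show ?thesis using suminf_split_head[OF sm] by simp
qed

text \<open>Comparing coefficients in \<open>g' = w h'\<close> bounds the coefficients of
  \<open>g\<close> by the convolution of those of \<open>w\<close> and \<open>h\<close> in modulus.
  Hence the majorant of \<open>g\<close> is at most the product of the majorants of \<open>w\<close>
  and \<open>h\<close>, and Bohr's inequality bounds the first factor by \<open>k\<close>.\<close>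

lemma sum_coeff_le_of_deriv_le:
  assumes h: "\<And>z. z \<in> ball 0 1 \<Longrightarrow> (\<lambda>n. a n * z ^ n) sums h z"
    and g: "\<And>z. z \<in> ball 0 1 \<Longrightarrow> (\<lambda>n. b n * z ^ n) sums g z"
    and hol: "w holomorphic_on ball 0 1"
    and w: "\<And>z. z \<in> ball 0 1 \<Longrightarrow> cmod (w z) \<le> k"
    and eq: "\<And>z. z \<in> ball 0 1 \<Longrightarrow> deriv g z = w z * deriv h z"
    and r: "0 \<le> r" "r \<le> 1 / 3"
  shows "(\<Sum>n. cmod (b (Suc n)) * r ^ Suc n) \<le> k * (\<Sum>n. cmod (a (Suc n)) * r ^ Suc n)"
proof -
  define c where "c n = (deriv ^^ n) w 0 / fact n" for n
  have c: "(\<lambda>n. c n * z ^ n) sums w z" if "z \<in> ball 0 1" for z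
    using holomorphic_power_series[OF hol that] by (simp add: c_def)
  define a' where "a' n = of_nat (Suc n) * a (Suc n)" for n
  have a': "(\<lambda>n. a' n * z ^ n) sums deriv h z" if "z \<in> ball 0 1" for z
    unfolding a'_def by (rule power_series_deriv[OF h that])
  have prod: "(\<lambda>n. (\<Sum>i\<le>n. c i * a' (n - i)) * z ^ n) sums deriv g z" if "z \<in> ball 0 1" for z
  proof -
    have 1: "summable (\<lambda>n. norm (c n * z ^ n))" "summable (\<lambda>n. norm (a' n * z ^ n))"
      using power_series_norm_summable[OF c, of "cmod z"] power_series_norm_summable[OF a', of "cmod z"] that
      by (simp_all add: norm_mult norm_power)
    have "(\<lambda>n. \<Sum>i\<le>n. c i * z ^ i * (a' (n - i) * z ^ (n - i))) sums (w z * deriv h z)"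
      using Cauchy_product_sums[OF 1] c[OF that] a'[OF that] by (simp add: sums_iff)
    also have "(\<lambda>n. \<Sum>i\<le>n. c i * z ^ i * (a' (n - i) * z ^ (n - i))) = (\<lambda>n. (\<Sum>i\<le>n. c i * a' (n - i)) * z ^ n)"
    proof
      fix n
      have "c i * z ^ i * (a' (n - i) * z ^ (n - i)) = c i * a' (n - i) * z ^ n" if "i \<in> {..n}" for i
        using that power_add[of z i "n - i"] by simp
      then have "(\<Sum>i\<le>n. c i * z ^ i * (a' (n - i) * z ^ (n - i))) = (\<Sum>i\<le>n. c i * a' (n - i) * z ^ n)"
        by (rule sum.cong[OF refl])
      then show "(\<Sum>i\<le>n. c i * z ^ i * (a' (n - i) * z ^ (n - i))) = (\<Sum>i\<le>n. c i * a' (n - i)) * z ^ n"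
        by (simp add: sum_distrib_right)
    qed
    finally show ?thesis using eq[OF that] by simp
  qed
  have b': "of_nat (Suc n) * b (Suc n) = (\<Sum>i\<le>n. c i * a' (n - i))" for n
    by (rule power_series_unique[OF power_series_deriv[OF g] prod])
  have bn: "cmod (b (Suc n)) \<le> (\<Sum>i\<le>n. cmod (c i) * cmod (a (Suc (n - i))))" for n
  proof -
    have "real (Suc n) * cmod (b (Suc n)) = cmod (\<Sum>i\<le>n. c i * a' (n - i))"
      by (metis b' norm_mult norm_of_nat)
    also have "\<dots> \<le> (\<Sum>i\<le>n. cmod (c i * a' (n - i)))" by (rule norm_sum)
    also have "\<dots> \<le> (\<Sum>i\<le>n. real (Suc n) * (cmod (c i) * cmod (a (Suc (n - i)))))"
    proof (rule sum_mono)
      fix i assume "i \<in> {..n}"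
      have "cmod (c i * a' (n - i)) = real (Suc (n - i)) * (cmod (c i) * cmod (a (Suc (n - i))))"
        unfolding a'_def norm_mult norm_of_nat by simp
      \<comment> \<open>The weight \<open>Suc (n - i)\<close> from differentiating \<open>h\<close>
        is at most \<open>Suc n\<close>, the weight from differentiating \<open>g\<close>, so the
        weights can be cancelled afterwards.\<close>
      also have "\<dots> \<le> real (Suc n) * (cmod (c i) * cmod (a (Suc (n - i))))"
        by (intro mult_right_mono) auto
      finally show "cmod (c i * a' (n - i)) \<le> real (Suc n) * (cmod (c i) * cmod (a (Suc (n - i))))" .
    qed
    finally have "real (Suc n) * cmod (b (Suc n)) \<le> real (Suc n) * (\<Sum>i\<le>n. cmod (c i) * cmod (a (Suc (n - i))))"
      by (simp only: sum_distrib_left)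
    then show ?thesis by (rule mult_left_le_imp_le) simp
  qed
  have sa: "summable (\<lambda>n. cmod (a (Suc n)) * r ^ Suc n)"
    using r by (intro summable_Suc_iff[THEN iffD2] power_series_norm_summable[OF h]) auto
  have sb: "summable (\<lambda>n. cmod (b (Suc n)) * r ^ Suc n)"
    using r by (intro summable_Suc_iff[THEN iffD2] power_series_norm_summable[OF g]) auto
  have sc: "summable (\<lambda>n. cmod (c n) * r ^ n)"
    using r by (intro power_series_norm_summable[OF c]) auto
  have cp: "(\<lambda>n. \<Sum>i\<le>n. cmod (c i) * r ^ i * (cmod (a (Suc (n - i))) * r ^ Suc (n - i)))
      sums ((\<Sum>n. cmod (c n) * r ^ n) * (\<Sum>n. cmod (a (Suc n)) * r ^ Suc n))"
    by (rule Cauchy_product_sums) (use sa sc r in \<open>simp_all add: abs_mult\<close>)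
  have "(\<Sum>n. cmod (b (Suc n)) * r ^ Suc n)
      \<le> (\<Sum>n. cmod (c n) * r ^ n) * (\<Sum>n. cmod (a (Suc n)) * r ^ Suc n)"
  proof (rule sums_le[OF _ summable_sums[OF sb] cp])
    fix n
    have "cmod (b (Suc n)) * r ^ Suc n \<le> (\<Sum>i\<le>n. cmod (c i) * cmod (a (Suc (n - i)))) * r ^ Suc n"
      using r by (intro mult_right_mono bn) auto
    also have "\<dots> = (\<Sum>i\<le>n. cmod (c i) * r ^ i * (cmod (a (Suc (n - i))) * r ^ Suc (n - i)))"
      unfolding sum_distrib_right
    proof (rule sum.cong[OF refl])
      fix i assume "i \<in> {..n}"
      then have "r ^ Suc n = r ^ i * r ^ Suc (n - i)" by (simp add: power_add[symmetric] Suc_diff_le)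
      then show "cmod (c i) * cmod (a (Suc (n - i))) * r ^ Suc n
        = cmod (c i) * r ^ i * (cmod (a (Suc (n - i))) * r ^ Suc (n - i))" by simp
    qed
    finally show "cmod (b (Suc n)) * r ^ Suc n
      \<le> (\<Sum>i\<le>n. cmod (c i) * r ^ i * (cmod (a (Suc (n - i))) * r ^ Suc (n - i)))" .
  qed
  also have "\<dots> \<le> k * (\<Sum>n. cmod (a (Suc n)) * r ^ Suc n)"
    using r by (intro mult_right_mono Bohr_inequality[OF c w] suminf_nonneg sa) auto
  finally show ?thesis .
qed

section \<open>The area integral\<close>

text \<open>Lebesgue measure is determined by its values on boxes, and a complex box corresponds to
  a rectangle in real coordinates. This opens integrals over the complex plane to Fubini's theorem
  in the coordinates.\<close>

lemma lborel_complex: "distr (lborel \<Otimes>\<^sub>M lborel) borel (\<lambda>(x, y). Complex x y) = lborel"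
proof (rule lborel_eqI[symmetric])
  fix l u :: complex
  assume le: "\<And>b. b \<in> Basis \<Longrightarrow> l \<bullet> b \<le> u \<bullet> b"
  have [measurable]: "(\<lambda>(x, y). Complex x y) \<in> borel_measurable (lborel \<Otimes>\<^sub>M lborel)"
    by (simp add: Complex_eq split_beta)
  have *: "(\<lambda>(x, y). Complex x y) -` box l u = {Re l<..<Re u} \<times> {Im l<..<Im u}"
    by (auto simp: box_def Basis_complex_def)
  show "emeasure (distr (lborel \<Otimes>\<^sub>M lborel) borel (\<lambda>(x, y). Complex x y)) (box l u)
      = ennreal (\<Prod>b\<in>Basis. (u - l) \<bullet> b)"
    using le[of 1] le[of \<i>]
    by (subst emeasure_distr)
      (simp_all add: * space_pair_measure lborel.emeasure_pair_measure_Times Basis_complex_def ennreal_mult)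
qed simp

text \<open>With the other coordinate fixed, a shear is a translation of the line, under which the
  inner integral is invariant.\<close>

lemma nn_integral_shear:
  fixes f :: "real \<times> real \<Rightarrow> ennreal"
  assumes [measurable]: "f \<in> borel_measurable (lborel \<Otimes>\<^sub>M lborel)"
  shows "(\<integral>\<^sup>+(x, y). f (x + t * y, y) \<partial>(lborel \<Otimes>\<^sub>M lborel)) = (\<integral>\<^sup>+p. f p \<partial>(lborel \<Otimes>\<^sub>M lborel))" (is ?A)
    and "(\<integral>\<^sup>+(x, y). f (x, y + t * x) \<partial>(lborel \<Otimes>\<^sub>M lborel)) = (\<integral>\<^sup>+p. f p \<partial>(lborel \<Otimes>\<^sub>M lborel))" (is ?B)
proof -
  have shift: "(\<integral>\<^sup>+x. g (x + c) \<partial>lborel) = (\<integral>\<^sup>+x. g x \<partial>lborel)"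
    if [measurable]: "g \<in> borel_measurable borel" for g :: "real \<Rightarrow> ennreal" and c
    using nn_integral_distr[of "(+) c" lborel borel g] by (simp add: lborel_distr_plus add.commute)
  have "(\<integral>\<^sup>+(x, y). f (x + t * y, y) \<partial>(lborel \<Otimes>\<^sub>M lborel)) = (\<integral>\<^sup>+y. \<integral>\<^sup>+x. f (x + t * y, y) \<partial>lborel \<partial>lborel)"
    by (subst lborel_pair.nn_integral_snd[symmetric]) simp_all
  also have "\<dots> = (\<integral>\<^sup>+y. \<integral>\<^sup>+x. f (x, y) \<partial>lborel \<partial>lborel)"
    by (intro nn_integral_cong shift) simp
  also have "\<dots> = (\<integral>\<^sup>+p. f p \<partial>(lborel \<Otimes>\<^sub>M lborel))"
    by (subst lborel_pair.nn_integral_snd) simp_all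
  finally show ?A .
  have "(\<integral>\<^sup>+(x, y). f (x, y + t * x) \<partial>(lborel \<Otimes>\<^sub>M lborel)) = (\<integral>\<^sup>+x. \<integral>\<^sup>+y. f (x, y + t * x) \<partial>lborel \<partial>lborel)"
    by (subst lborel.nn_integral_fst[symmetric]) simp_all
  also have "\<dots> = (\<integral>\<^sup>+x. \<integral>\<^sup>+y. f (x, y) \<partial>lborel \<partial>lborel)"
    by (intro nn_integral_cong shift) simp
  also have "\<dots> = (\<integral>\<^sup>+p. f p \<partial>(lborel \<Otimes>\<^sub>M lborel))"
    by (subst lborel.nn_integral_fst) simp_all
  finally show ?B .
qed

text \<open>A rotation is a composition of three shears.\<close>

lemma lborel_rotation:
  fixes c :: complex
  assumes c: "cmod c = 1" and "Re c \<noteq> - 1"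
  shows "distr lborel borel ((*) c) = lborel"
proof (rule measure_eqI)
  fix A assume "A \<in> sets (distr lborel borel ((*) c))"
  then have [measurable]: "A \<in> sets borel" by simp
  \<comment> \<open>For \<open>c = cis \<theta>\<close> this is \<open>- tan (\<theta> / 2)\<close>.
    The rotation is the product of a horizontal, a vertical and a horizontal shear with factors
    \<open>t\<close>, \<open>Im c\<close>, \<open>t\<close>; \<open>t2\<close> and \<open>t3\<close>
    below identify the entries of that product.\<close>
  define t where "t = - Im c / (1 + Re c)"
  have "1 + Re c \<noteq> 0" using assms(2) by linarith
  then have t1: "t * (1 + Re c) = - Im c" by (simp add: t_def)
  have "(Re c)\<^sup>2 + (Im c)\<^sup>2 = 1" using c by (simp flip: cmod_power2)
  then have "(1 + Re c) * (1 - Re c) = - (- Im c) * Im c"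
    by (simp add: algebra_simps power2_eq_square)
  also have "\<dots> = (1 + Re c) * (- t * Im c)"
    unfolding t1[symmetric] by (simp add: algebra_simps)
  finally have "(1 + Re c) * (1 - Re c) = (1 + Re c) * (- t * Im c)" .
  then have "1 - Re c = - t * Im c" using \<open>1 + Re c \<noteq> 0\<close> by (simp only: mult_cancel_left) simp
  then have t2: "1 + t * Im c = Re c" by simp
  have t3: "t + t * Re c = - Im c" using t1 by (simp add: algebra_simps)
  define f :: "real \<times> real \<Rightarrow> ennreal" where "f p = indicator A (case p of (x, y) \<Rightarrow> Complex x y)" for p
  define F where "F = (\<lambda>(x, y). f (x + t * y, y) :: ennreal)"
  define G where "G = (\<lambda>(x, y). F (x, y + Im c * x))"
  have [measurable]: "(\<lambda>(x, y). Complex x y) \<in> borel_measurable (lborel \<Otimes>\<^sub>M lborel)"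
    by (simp add: Complex_eq split_beta)
  then have [measurable]: "(\<lambda>(x, y). Complex x y) \<in> borel_measurable (borel \<Otimes>\<^sub>M borel)"
    by (simp add: measurable_def space_pair_measure cong: sets_pair_measure_cong)
  have f [measurable]: "f \<in> borel_measurable (lborel \<Otimes>\<^sub>M lborel)" unfolding f_def by measurable
  have F [measurable]: "F \<in> borel_measurable (lborel \<Otimes>\<^sub>M lborel)" unfolding F_def by measurable
  have G [measurable]: "G \<in> borel_measurable (lborel \<Otimes>\<^sub>M lborel)" unfolding G_def by measurable
  have eq: "indicator A (c * Complex x y) = G (x + t * y, y)" for x y
  proof -
    have "c * Complex x y = Complex (x + t * y + t * (y + Im c * (x + t * y))) (y + Im c * (x + t * y))"
    proof (rule complex_eqI)
      have "x + t * y + t * (y + Im c * (x + t * y)) = x * (1 + t * Im c) + y * (t + t * (1 + t * Im c))"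
        by (simp add: algebra_simps)
      also have "\<dots> = Re c * x - Im c * y" unfolding t2 t3 by (simp add: algebra_simps)
      finally show "Re (c * Complex x y) = Re (Complex (x + t * y + t * (y + Im c * (x + t * y))) (y + Im c * (x + t * y)))" by simp
      have "y + Im c * (x + t * y) = Im c * x + y * (1 + t * Im c)"
        by (simp add: algebra_simps)
      also have "\<dots> = Im c * x + Re c * y" unfolding t2 by simp
      finally show "Im (c * Complex x y) = Im (Complex (x + t * y + t * (y + Im c * (x + t * y))) (y + Im c * (x + t * y)))" by simp
    qed
    then show ?thesis by (simp add: G_def F_def f_def)
  qed
  have "emeasure (distr lborel borel ((*) c)) A = (\<integral>\<^sup>+z. indicator A z \<partial>distr lborel borel ((*) c))"
    by simp
  also have "\<dots> = (\<integral>\<^sup>+z. indicator A (c * z) \<partial>lborel)"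
    by (rule nn_integral_distr) simp_all
  also have "\<dots> = (\<integral>\<^sup>+z. indicator A (c * z) \<partial>distr (lborel \<Otimes>\<^sub>M lborel) borel (\<lambda>(x, y). Complex x y))"
    by (simp only: lborel_complex)
  also have "\<dots> = (\<integral>\<^sup>+p. indicator A (c * (case p of (x, y) \<Rightarrow> Complex x y)) \<partial>(lborel \<Otimes>\<^sub>M lborel))"
    by (rule nn_integral_distr) simp_all
  also have "\<dots> = (\<integral>\<^sup>+(x, y). G (x + t * y, y) \<partial>(lborel \<Otimes>\<^sub>M lborel))"
    by (intro nn_integral_cong) (auto simp: eq)
  also have "\<dots> = (\<integral>\<^sup>+(x, y). F (x, y + Im c * x) \<partial>(lborel \<Otimes>\<^sub>M lborel))"
    using nn_integral_shear(1)[OF G] by (simp add: G_def)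
  also have "\<dots> = (\<integral>\<^sup>+(x, y). f (x + t * y, y) \<partial>(lborel \<Otimes>\<^sub>M lborel))"
    using nn_integral_shear(2)[OF F] by (simp add: F_def)
  also have "\<dots> = (\<integral>\<^sup>+p. f p \<partial>(lborel \<Otimes>\<^sub>M lborel))"
    by (rule nn_integral_shear(1)[OF f])
  also have "\<dots> = (\<integral>\<^sup>+z. indicator A z \<partial>distr (lborel \<Otimes>\<^sub>M lborel) borel (\<lambda>(x, y). Complex x y))"
    unfolding f_def by (rule nn_integral_distr[symmetric]) simp_all
  also have "\<dots> = emeasure lborel A" by (simp add: lborel_complex)
  finally show "emeasure (distr lborel borel ((*) c)) A = emeasure lborel A" .
qed simp

section \<open>Monomials on a disc: orthogonality and moments\<close>

text \<open>The rotation by \<open>c\<close> preserves the disc and the measure but multiplies the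
  integrand by \<open>c ^ m * cnj c ^ n\<close>. As soon as this factor is not 1, the integral must
  vanish.\<close>

lemma integral_monomials_orthogonal:
  fixes m n :: nat
  assumes "m \<noteq> n"
  shows "(LINT z|lborel. indicator (ball 0 r) z *\<^sub>R (z ^ m * cnj z ^ n)) = (0::complex)"
proof -
  define N where "N = max m n - min m n"
  have N: "0 < N" using assms by (auto simp: N_def)
  \<comment> \<open>This choice gives \<open>c ^ N = \<i>\<close>, so the factor is
    \<open>\<i>\<close> or \<open>- \<i>\<close>, depending on which exponent is larger. The angle
    is at most a right angle, which keeps \<open>Re c\<close> away from \<open>- 1\<close>.\<close>
  define c where "c = cis (pi / (2 * real N))"
  have cm: "cmod c = 1" by (simp add: c_def)
  have "pi / (2 * real N) \<le> pi / 2" using N by (intro divide_left_mono) auto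
  moreover have "0 \<le> pi / (2 * real N)" by simp
  ultimately have "0 \<le> Re c" unfolding c_def cis.sel by (intro cos_ge_zero) linarith+
  then have rot: "distr lborel borel ((*) c) = lborel" by (intro lborel_rotation cm) auto
  have cN: "c ^ N = \<i>" using N by (simp add: c_def Complex.DeMoivre)
  have cc: "c * cnj c = 1" by (simp add: c_def cis_cnj cis_mult)
  have ne: "c ^ m * cnj c ^ n \<noteq> 1"
  proof (cases "m \<le> n")
    case True
    then have "n = m + N" by (simp add: N_def)
    then have "c ^ m * cnj c ^ n = (c * cnj c) ^ m * cnj (c ^ N)"
      by (simp add: power_add power_mult_distrib mult_ac)
    then show ?thesis by (simp add: cc cN complex_eq_iff)
  next
    case False
    then have "m = n + N" by (simp add: N_def)
    then have "c ^ m * cnj c ^ n = (c * cnj c) ^ n * c ^ N"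
      by (simp add: power_add power_mult_distrib mult_ac)
    then show ?thesis by (simp add: cc cN complex_eq_iff)
  qed
  define I where "I = (LINT z|lborel. indicator (ball 0 r) z *\<^sub>R (z ^ m * cnj z ^ n))"
  have "I = (LINT z|distr lborel borel ((*) c). indicator (ball 0 r) z *\<^sub>R (z ^ m * cnj z ^ n))"
    by (simp add: I_def rot)
  also have "\<dots> = (LINT z|lborel. indicator (ball 0 r) (c * z) *\<^sub>R ((c * z) ^ m * cnj (c * z) ^ n))"
  proof (rule integral_distr)
    show "(\<lambda>z. indicator (ball 0 r) z *\<^sub>R (z ^ m * cnj z ^ n)) \<in> borel_measurable borel"
      by (intro borel_measurable_scaleR borel_measurable_indicator borel_measurable_continuous_onI
          continuous_intros) simp
  qed simp
  also have "\<dots> = (LINT z|lborel. (c ^ m * cnj c ^ n) * (indicator (ball 0 r) z *\<^sub>R (z ^ m * cnj z ^ n)))"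
    by (intro Bochner_Integration.integral_cong)
      (auto simp: indicator_def norm_mult cm power_mult_distrib)
  also have "\<dots> = (c ^ m * cnj c ^ n) * I"
    unfolding I_def by (rule integral_mult_right_zero)
  finally have "(c ^ m * cnj c ^ n - 1) * I = 0" by (simp add: algebra_simps)
  then show ?thesis using ne by (simp add: I_def)
qed

text \<open>Layer cake: \<open>|z|\<^sup>2\<^sup>n\<close> is the integral of \<open>d t = 2 n t\<^sup>2\<^sup>n\<^sup>-\<^sup>1\<close> up to \<open>|z|\<close>, and the order of
  integration is exchanged.\<close>

lemma integral_moment_disc:
  assumes "0 \<le> r"
  shows "(LINT z|lborel. indicator (ball 0 r) z * (cmod z ^ (2 * n))) = pi * r ^ (2 * n + 2) / real (n + 1)"
proof (rule integral_eq_nn_integral[THEN trans])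
  show "(\<lambda>z. indicator (ball 0 r) z * (cmod z ^ (2 * n))) \<in> borel_measurable (lborel :: complex measure)"
    by (intro borel_measurable_times borel_measurable_indicator borel_measurable_power borel_measurable_norm) simp_all
  show "AE z in (lborel :: complex measure). 0 \<le> indicator (ball 0 r) z * (cmod z ^ (2 * n))" by simp
  have area: "emeasure lborel (ball (0::complex) s) = ennreal (pi * s\<^sup>2)" if "0 \<le> s" for s
    using that by (simp add: emeasure_ball unit_ball_vol_2)
  have *: "ennreal (pi * r ^ (2 * n + 2) / real (n + 1)) = (\<integral>\<^sup>+z. ennreal (indicator (ball (0::complex) r) z * (cmod z ^ (2 * n))) \<partial>lborel)"
  \<comment> \<open>For \<open>n = 0\<close> the moment is the area of the disc. Otherwise the
    exponent \<open>2 * n - 1\<close> is not truncated and \<open>0 ^ (2 * n) = 0\<close>, so the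
    layer cake formula has no constant term.\<close>
  proof (cases "n = 0")
    case True
    then show ?thesis using area[OF assms]
      by (simp add: power2_eq_square ennreal_indicator)
  next
    case False
    define d where "d t = real (2 * n) * t ^ (2 * n - 1)" for t :: real
    have d0: "0 \<le> d t" if "0 \<le> t" for t using that by (simp add: d_def)
    have dd: "((\<lambda>t. t ^ (2 * n)) has_real_derivative d t) (at t)" for t
      unfolding d_def using DERIV_pow[of "2 * n" t] by simp
    have [measurable]: "d \<in> borel_measurable borel" unfolding d_def by measurable
    have 1: "ennreal (indicator (ball 0 r) z * (cmod z ^ (2 * n)))
        = (\<integral>\<^sup>+t. ennreal (d t) * indicator {0..r} t * indicator {p. fst p \<le> cmod (snd p) \<and> cmod (snd p) < r} (t, z) \<partial>lborel)" for z :: complex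
    proof (cases "cmod z < r")
      case True
      have "(\<integral>\<^sup>+t. ennreal (d t) * indicator {0..cmod z} t \<partial>lborel) = ennreal (cmod z ^ (2 * n) - 0 ^ (2 * n))"
        by (rule nn_integral_FTC_Icc) (auto intro: d0 DERIV_subset[OF dd] simp: has_field_derivative_at_within dd)
      also have "(\<integral>\<^sup>+t. ennreal (d t) * indicator {0..cmod z} t \<partial>lborel)
        = (\<integral>\<^sup>+t. ennreal (d t) * indicator {0..r} t * indicator {p. fst p \<le> cmod (snd p) \<and> cmod (snd p) < r} (t, z) \<partial>lborel)"
        using True by (intro nn_integral_cong) (auto simp: indicator_def)
      finally show ?thesis using True False by simp
    next
      case False then show ?thesis by simp
    qed
    have meas [measurable]: "(\<lambda>(t, z). ennreal (d t) * indicator {0..r} t * indicator {p. fst p \<le> cmod (snd p) \<and> cmod (snd p) < r} (t, z))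
      \<in> borel_measurable (lborel \<Otimes>\<^sub>M (lborel :: complex measure))"
      by measurable
    \<comment> \<open>For fixed \<open>t\<close> the region is the annulus
      \<open>t \<le> cmod z < r\<close>, whose area is a difference of two disc areas.\<close>
    have 2: "(\<integral>\<^sup>+z. ennreal (d t) * indicator {0..r} t * indicator {p. fst p \<le> cmod (snd p) \<and> cmod (snd p) < r} (t, z :: complex) \<partial>lborel)
       = ennreal (d t * (pi * r\<^sup>2 - pi * t\<^sup>2)) * indicator {0..r} t" for t
    proof (cases "0 \<le> t \<and> t \<le> r")
      case True
      have "emeasure lborel (ball (0::complex) r - ball 0 t) = ennreal (pi * r\<^sup>2) - ennreal (pi * t\<^sup>2)"
        using True area[of r] area[of t] by (subst emeasure_Diff) auto
      also have "\<dots> = ennreal (pi * r\<^sup>2 - pi * t\<^sup>2)" by (simp add: ennreal_minus)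
      finally have e: "emeasure lborel (ball (0::complex) r - ball 0 t) = ennreal (pi * r\<^sup>2 - pi * t\<^sup>2)" .
      have "(\<integral>\<^sup>+z. ennreal (d t) * indicator {0..r} t * indicator {p. fst p \<le> cmod (snd p) \<and> cmod (snd p) < r} (t, z :: complex) \<partial>lborel)
        = (\<integral>\<^sup>+z. ennreal (d t) * indicator (ball (0::complex) r - ball 0 t) z \<partial>lborel)"
        using True by (intro nn_integral_cong) (auto simp: indicator_def)
      also have "\<dots> = ennreal (d t) * ennreal (pi * r\<^sup>2 - pi * t\<^sup>2)"
        by (simp add: nn_integral_cmult_indicator e)
      finally show ?thesis using True d0[of t] by (simp add: ennreal_mult')
    next
      case False then show ?thesis by (auto simp: indicator_def)
    qed
    \<comment> \<open>An antiderivative of the function of \<open>t\<close> that remains after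
      integrating over \<open>z\<close>.\<close>
    define Q where "Q t = pi * r\<^sup>2 * t ^ (2 * n) - pi * (real (2 * n) * t ^ (2 * n + 2) / real (2 * n + 2))" for t
    have dQ: "(Q has_real_derivative d t * (pi * r\<^sup>2 - pi * t\<^sup>2)) (at t)" for t
    proof -
      have "(Q has_real_derivative pi * r\<^sup>2 * d t - pi * (real (2 * n) * (real (2 * n + 2) * t ^ (2 * n + 1)) / real (2 * n + 2))) (at t)"
        unfolding Q_def using DERIV_pow[of "2 * n + 2" t]
        by (intro derivative_intros DERIV_cmult DERIV_cdivide dd) auto
      also have "pi * r\<^sup>2 * d t - pi * (real (2 * n) * (real (2 * n + 2) * t ^ (2 * n + 1)) / real (2 * n + 2)) = d t * (pi * r\<^sup>2 - pi * t\<^sup>2)"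
      proof -
        have "t ^ (2 * n + 1) = t ^ (2 * n - 1) * t\<^sup>2"
          using False by (simp flip: power_add)
        moreover have "A * (B * x) / B = A * x" if "B \<noteq> 0" for A B x :: real using that by simp
        ultimately show ?thesis by (simp add: d_def algebra_simps del: of_nat_add of_nat_mult of_nat_Suc)
      qed
      finally show ?thesis .
    qed
    have "(\<integral>\<^sup>+z. ennreal (indicator (ball (0::complex) r) z * (cmod z ^ (2 * n))) \<partial>lborel)
      = (\<integral>\<^sup>+z. \<integral>\<^sup>+t. ennreal (d t) * indicator {0..r} t * indicator {p. fst p \<le> cmod (snd p) \<and> cmod (snd p) < r} (t, z :: complex) \<partial>lborel \<partial>lborel)"
      by (simp only: 1)
    also have "\<dots> = (\<integral>\<^sup>+t. \<integral>\<^sup>+z. ennreal (d t) * indicator {0..r} t * indicator {p. fst p \<le> cmod (snd p) \<and> cmod (snd p) < r} (t, z :: complex) \<partial>lborel \<partial>lborel)"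
      by (rule lborel_pair.Fubini') (rule meas)
    also have "\<dots> = (\<integral>\<^sup>+t. ennreal (d t * (pi * r\<^sup>2 - pi * t\<^sup>2)) * indicator {0..r} t \<partial>lborel)"
      by (simp only: 2)
    also have "\<dots> = ennreal (Q r - Q 0)"
    proof (rule nn_integral_FTC_Icc)
      fix t assume "t \<in> {0..r}"
      then show "0 \<le> d t * (pi * r\<^sup>2 - pi * t\<^sup>2)"
        by (intro mult_nonneg_nonneg d0) (auto simp: power_mono)
    qed (use assms in \<open>auto intro: has_field_derivative_at_within dQ\<close>)
    also have "Q r - Q 0 = pi * r ^ (2 * n + 2) / real (n + 1)"
      using False by (simp add: Q_def zero_power field_simps power2_eq_square)
    finally show ?thesis ..
  qed
  show "enn2real (\<integral>\<^sup>+z. ennreal (indicator (ball (0::complex) r) z * (cmod z ^ (2 * n))) \<partial>lborel) = pi * r ^ (2 * n + 2) / real (n + 1)"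
    unfolding *[symmetric] using assms by simp
qed


lemma set_integrable_ball:
  fixes f :: "complex \<Rightarrow> 'b::euclidean_space"
  assumes "continuous_on (cball 0 r) f"
  shows "integrable lborel (\<lambda>z. indicator (ball 0 r) z *\<^sub>R f z)"
proof -
  have "set_integrable lborel (cball 0 r) f"
    unfolding set_integrable_def using assms by (intro borel_integrable_compact) auto
  then have "set_integrable lborel (ball 0 r) f"
    by (rule set_integrable_subset) auto
  then show ?thesis by (simp add: set_integrable_def)
qed

text \<open>Parseval's identity on a disc: the squared modulus expands into a double sum, the mixed
  terms integrate to 0 by orthogonality, and the diagonal terms are the moments.\<close>

lemma integral_square_polynomial_disc:
  fixes c :: "nat \<Rightarrow> complex"
  assumes "0 \<le> r"
  shows "(LINT z|lborel. indicator (ball 0 r) z * (cmod (\<Sum>n<N. c n * z ^ n))\<^sup>2)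
    = (\<Sum>n<N. pi * ((cmod (c n))\<^sup>2 * r ^ (2 * n + 2) / real (n + 1)))"
proof -
  define J where "J m n = (LINT z|lborel. indicator (ball 0 r) z *\<^sub>R (z ^ m * cnj z ^ n))" for m n
  have diag: "J n n = of_real (pi * r ^ (2 * n + 2) / real (n + 1))" for n
  proof -
    have "J n n = (LINT z|lborel. of_real (indicator (ball 0 r) z * cmod z ^ (2 * n)))"
      unfolding J_def
    proof (rule Bochner_Integration.integral_cong[OF refl])
      fix z :: complex
      have "z ^ n * cnj z ^ n = (z * cnj z) ^ n" by (simp add: power_mult_distrib)
      also have "\<dots> = of_real (cmod z ^ (2 * n))"
        by (simp only: complex_norm_square[symmetric] power_mult of_real_power)
      finally show "indicator (ball 0 r) z *\<^sub>R (z ^ n * cnj z ^ n) = of_real (indicator (ball 0 r) z * cmod z ^ (2 * n))"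
        by (simp add: scaleR_conv_of_real)
    qed
    also have "\<dots> = of_real (LINT z|lborel. indicator (ball 0 r) z * cmod z ^ (2 * n))"
      by (rule integral_complex_of_real)
    finally show ?thesis by (simp only: integral_moment_disc[OF assms])
  qed
  have int: "integrable lborel (\<lambda>z. indicator (ball 0 r) z *\<^sub>R (z ^ m * cnj z ^ n))" for m n
    by (intro set_integrable_ball continuous_intros)
  have "of_real (LINT z|lborel. indicator (ball 0 r) z * (cmod (\<Sum>n<N. c n * z ^ n))\<^sup>2)
     = (LINT z|lborel. of_real (indicator (ball 0 r) z * (cmod (\<Sum>n<N. c n * z ^ n))\<^sup>2) :: complex)"
    by (rule integral_complex_of_real[symmetric])
  also have "\<dots> = (LINT z|lborel. (\<Sum>m<N. \<Sum>n<N. (c m * cnj (c n)) * (indicator (ball 0 r) z *\<^sub>R (z ^ m * cnj z ^ n))))"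
  proof (rule Bochner_Integration.integral_cong[OF refl])
    fix z :: complex
    have "of_real ((cmod (\<Sum>n<N. c n * z ^ n))\<^sup>2) = (\<Sum>m<N. c m * z ^ m) * (\<Sum>n<N. cnj (c n) * cnj z ^ n)"
      by (simp only: complex_norm_square cnj_sum complex_cnj_mult complex_cnj_power)
    also have "\<dots> = (\<Sum>m<N. \<Sum>n<N. (c m * cnj (c n)) * (z ^ m * cnj z ^ n))"
      by (simp add: sum_product mult_ac)
    finally show "of_real (indicator (ball 0 r) z * (cmod (\<Sum>n<N. c n * z ^ n))\<^sup>2)
        = (\<Sum>m<N. \<Sum>n<N. (c m * cnj (c n)) * (indicator (ball 0 r) z *\<^sub>R (z ^ m * cnj z ^ n)))"
      by (simp add: indicator_def)
  qed
  also have "\<dots> = (\<Sum>m<N. \<Sum>n<N. (c m * cnj (c n)) * J m n)"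
    by (simp only: Bochner_Integration.integral_sum Bochner_Integration.integrable_sum
        integrable_mult_right int integral_mult_right_zero J_def)
  also have "\<dots> = (\<Sum>m<N. \<Sum>n<N. if m = n then (c m * cnj (c n)) * J m n else 0)"
    using integral_monomials_orthogonal by (intro sum.cong refl) (auto simp: J_def)
  also have "\<dots> = (\<Sum>m<N. (c m * cnj (c m)) * J m m)" by (simp add: sum.delta)
  also have "\<dots> = of_real (\<Sum>n<N. pi * ((cmod (c n))\<^sup>2 * r ^ (2 * n + 2) / real (n + 1)))"
    by (simp add: diag complex_norm_square[symmetric] mult_ac del: of_nat_add of_nat_Suc)
  finally show ?thesis by (simp only: of_real_eq_iff)
qed

section \<open>The area integral as a coefficient series\<close>

text \<open>Parseval's identity is applied to the partial sums of \<open>deriv h\<close>, and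
  dominated convergence passes to the limit.\<close>

lemma area_integral_sums:
  assumes h: "\<And>z. z \<in> ball 0 1 \<Longrightarrow> (\<lambda>n. a n * z ^ n) sums h z" and r: "0 \<le> r" "r < 1"
  shows "(\<lambda>n. pi * (real (Suc n) * (cmod (a (Suc n)))\<^sup>2 * r ^ (2 * Suc n))) sums area_integral h r"
proof -
  define c where "c n = of_nat (Suc n) * a (Suc n)" for n
  have c: "(\<lambda>n. c n * z ^ n) sums deriv h z" if "z \<in> ball 0 1" for z
    unfolding c_def by (rule power_series_deriv[OF h that])
  have sm: "summable (\<lambda>n. cmod (c n) * r ^ n)"
    using r by (intro power_series_norm_summable[OF c]) auto
  \<comment> \<open>The majorant of \<open>deriv h\<close> at \<open>r\<close> bounds all partial
    sums on the disc of radius \<open>r\<close> at once, so its square is the dominating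
    constant.\<close>
  define C where "C = (\<Sum>n. cmod (c n) * r ^ n)"
  have bound: "cmod (\<Sum>n<N. c n * z ^ n) \<le> C" if "cmod z < r" for z N
  proof -
    have "cmod (\<Sum>n<N. c n * z ^ n) \<le> (\<Sum>n<N. cmod (c n) * r ^ n)"
      using that by (intro sum_norm_le) (auto simp: norm_mult norm_power intro!: mult_left_mono power_mono)
    also have "\<dots> \<le> C" unfolding C_def by (rule sum_le_suminf[OF sm]) (use r in auto)
    finally show ?thesis .
  qed
  have lim: "(\<lambda>N. indicator (ball 0 r) z * (cmod (\<Sum>n<N. c n * z ^ n))\<^sup>2)
      \<longlonglongrightarrow> indicator (ball 0 r) z *\<^sub>R (cmod (deriv h z))\<^sup>2" for z
  proof (cases "z \<in> ball 0 r")
    case True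
    then have "z \<in> ball 0 1" using r by auto
    then show ?thesis using True c[of z] by (auto intro!: tendsto_intros simp: sums_def)
  qed simp
  have meas: "(\<lambda>z. indicator (ball 0 r) z * (cmod (\<Sum>n<N. c n * z ^ n))\<^sup>2) \<in> borel_measurable lborel" for N
    by (intro borel_measurable_times borel_measurable_indicator borel_measurable_power
        borel_measurable_norm borel_measurable_sum) simp_all
  have "(\<lambda>N. LINT z|lborel. indicator (ball 0 r) z * (cmod (\<Sum>n<N. c n * z ^ n))\<^sup>2)
      \<longlonglongrightarrow> (LINT z|lborel. indicator (ball 0 r) z *\<^sub>R (cmod (deriv h z))\<^sup>2)"
  proof (rule integral_dominated_convergence[where w="\<lambda>z. indicator (ball 0 r) z *\<^sub>R C\<^sup>2"])
    show "(\<lambda>z. indicator (ball 0 r) z *\<^sub>R (cmod (deriv h z))\<^sup>2) \<in> borel_measurable lborel"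
      by (rule borel_measurable_LIMSEQ_metric[OF meas lim])
    show "integrable lborel (\<lambda>z::complex. indicator (ball 0 r) z *\<^sub>R C\<^sup>2)"
      by (intro set_integrable_ball continuous_intros)
    show "AE z in lborel. norm (indicator (ball 0 r) z * (cmod (\<Sum>n<N. c n * z ^ n))\<^sup>2) \<le> indicator (ball 0 r) z *\<^sub>R C\<^sup>2" for N
      by (intro AE_I2) (auto simp: indicator_def intro!: power_mono bound)
  qed (use meas lim in auto)
  \<comment> \<open>Squaring \<open>c n\<close> gives the factor \<open>Suc n\<close> twice, and the
    moment divides one of them away.\<close>
  moreover have "pi * ((cmod (c n))\<^sup>2 * r ^ (2 * n + 2) / real (n + 1)) = pi * (real (Suc n) * (cmod (a (Suc n)))\<^sup>2 * r ^ (2 * Suc n))" for n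
  proof -
    have "(cmod (c n))\<^sup>2 = real (Suc n) * real (Suc n) * (cmod (a (Suc n)))\<^sup>2"
      by (simp add: c_def norm_mult power2_eq_square del: of_nat_Suc)
    then show ?thesis by (simp del: of_nat_Suc of_nat_add)
  qed
  ultimately show ?thesis
    unfolding sums_def area_integral_def set_lebesgue_integral_def
    by (simp only: integral_square_polynomial_disc[OF r(1)])
qed

text \<open>Termwise comparison with the differentiated geometric series at
  \<open>r\<^sup>2\<close>. The first part serves the inequality; the second, where all moduli equal
  \<open>M\<close>, evaluates the extremal function.\<close>

lemma area_integral_geometric_le:
  assumes h: "\<And>z. z \<in> ball 0 1 \<Longrightarrow> (\<lambda>n. a n * z ^ n) sums h z" and r: "0 \<le> r" "r < 1"
    and a: "\<And>n. cmod (a (Suc n)) \<le> M"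
  shows "sqrt (area_integral h r / pi) \<le> M * r / (1 - r\<^sup>2)"
    and "(\<And>n. cmod (a (Suc n)) = M) \<Longrightarrow> sqrt (area_integral h r / pi) = M * r / (1 - r\<^sup>2)"
proof -
  have M: "0 \<le> M" using a[of 0] norm_ge_zero order_trans by blast
  have r2: "r\<^sup>2 < 1" using r by (simp add: power_less_one_iff)
  have "(\<lambda>n. real (Suc n) * (r\<^sup>2) ^ n) sums (1 / (1 - r\<^sup>2)\<^sup>2)"
    using geometric_deriv_sums[of "r\<^sup>2"] r2 by simp
  then have "(\<lambda>n. pi * (M\<^sup>2 * r\<^sup>2) * (real (Suc n) * (r\<^sup>2) ^ n)) sums (pi * (M\<^sup>2 * r\<^sup>2) * (1 / (1 - r\<^sup>2)\<^sup>2))"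
    by (rule sums_mult)
  also have "(\<lambda>n. pi * (M\<^sup>2 * r\<^sup>2) * (real (Suc n) * (r\<^sup>2) ^ n)) = (\<lambda>n. pi * (real (Suc n) * M\<^sup>2 * r ^ (2 * Suc n)))"
  proof
    fix n
    have "r ^ (2 * Suc n) = r\<^sup>2 * (r\<^sup>2) ^ n" by (simp only: power_mult power_Suc)
    then show "pi * (M\<^sup>2 * r\<^sup>2) * (real (Suc n) * (r\<^sup>2) ^ n) = pi * (real (Suc n) * M\<^sup>2 * r ^ (2 * Suc n))"
      by simp
  qed
  also have "pi * (M\<^sup>2 * r\<^sup>2) * (1 / (1 - r\<^sup>2)\<^sup>2) = pi * (M * r / (1 - r\<^sup>2))\<^sup>2"
    by (simp add: power_divide power_mult_distrib)
  finally have s: "(\<lambda>n. pi * (real (Suc n) * M\<^sup>2 * r ^ (2 * Suc n))) sums (pi * (M * r / (1 - r\<^sup>2))\<^sup>2)" .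
  have nn: "0 \<le> M * r / (1 - r\<^sup>2)" using M r r2 by simp
  have "area_integral h r \<le> pi * (M * r / (1 - r\<^sup>2))\<^sup>2"
    using r a by (intro sums_le[OF _ area_integral_sums[OF h r] s] mult_left_mono mult_right_mono power_mono) auto
  then have "area_integral h r / pi \<le> (M * r / (1 - r\<^sup>2))\<^sup>2"
    by (simp add: divide_le_eq mult.commute)
  then show "sqrt (area_integral h r / pi) \<le> M * r / (1 - r\<^sup>2)"
    using nn real_le_lsqrt by blast
  assume "\<And>n. cmod (a (Suc n)) = M"
  then have "area_integral h r = pi * (M * r / (1 - r\<^sup>2))\<^sup>2"
    using sums_unique2[OF area_integral_sums[OF h r]] s by simp
  then have "area_integral h r / pi = (M * r / (1 - r\<^sup>2))\<^sup>2" by simp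
  then show "sqrt (area_integral h r / pi) = M * r / (1 - r\<^sup>2)"
    using nn by (simp only: real_sqrt_abs abs_of_nonneg)
qed

section \<open>The Bohr radius\<close>

text \<open>Otherwise the inverse of \<open>\<phi>\<close> would be a bounded entire function, hence
  constant by Liouville. It follows that the image has a nonempty boundary, on which the distance is
  attained.\<close>

lemma univalent_disc_image_not_UNIV:
  assumes "\<phi> holomorphic_on ball 0 1" "inj_on \<phi> (ball 0 1)"
  shows "\<phi> ` ball 0 1 \<noteq> UNIV"
proof
  assume U: "\<phi> ` ball 0 1 = UNIV"
  obtain g where "g holomorphic_on \<phi> ` ball 0 1" and g: "\<And>z. z \<in> ball 0 1 \<Longrightarrow> g (\<phi> z) = z"
    using holomorphic_has_inverse[OF assms(1) open_ball assms(2)] by blast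
  then have "g holomorphic_on UNIV" using U by simp
  moreover have "range g = ball 0 1" unfolding U[symmetric] by (simp add: image_image g)
  ultimately have "g constant_on UNIV" using Liouville_theorem[of g] by simp
  then obtain k where "\<And>x. g x = k" by (auto simp: constant_on_def)
  then have "g (\<phi> 0) = g (\<phi> (1/2))" by simp
  then show False using g[of 0] g[of "1/2"] by simp
qed

text \<open>A line through the nearest boundary point \<open>p\<close> bounds a half-plane
  containing the image \<open>S\<close>. Subordination puts the values of \<open>h\<close> into
  \<open>S\<close> and gives \<open>a 0 = \<phi> 0\<close>, so Caratheodory's estimate for
  \<open>u * (p - h z)\<close> yields at most \<open>2 * cmod (p - \<phi> 0)\<close>.\<close>

lemma subordinate_convex_coeff_le:
  assumes \<phi>: "univalent_convex \<phi>" and sub: "subordinate h \<phi>"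
    and h: "\<And>z. z \<in> ball 0 1 \<Longrightarrow> (\<lambda>n. a n * z ^ n) sums h z"
  shows "cmod (a (Suc n)) \<le> 2 * infdist (\<phi> 0) (frontier (\<phi> ` ball 0 1))"
proof -
  define S where "S = \<phi> ` ball 0 1"
  have hol: "\<phi> holomorphic_on ball 0 1" and inj: "inj_on \<phi> (ball 0 1)" and conv: "convex S"
    using \<phi> by (auto simp: univalent_convex_def S_def)
  have "open S" unfolding S_def by (rule open_mapping_thm3[OF hol open_ball inj])
  have ne: "S \<noteq> {}" by (simp add: S_def)
  have "frontier S \<noteq> {}"
    using univalent_disc_image_not_UNIV[OF hol inj] ne by (simp add: S_def frontier_eq_empty)
  then obtain p where p: "p \<in> frontier S" "infdist (\<phi> 0) (frontier S) = dist (\<phi> 0) p"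
    using infdist_attains_inf[of "frontier S" "\<phi> 0"] by auto
  have "p \<notin> S" using p(1) \<open>open S\<close> by (simp add: frontier_def interior_open)
  then obtain v b where v: "v \<noteq> 0" "\<And>x. x \<in> S \<Longrightarrow> v \<bullet> x \<le> b" "b \<le> v \<bullet> p"
    using separating_hyperplane_sets[of S "{p}"] conv ne by auto
  \<comment> \<open>Multiplication by the conjugate of the unit normal turns the real inner product
    with that normal into a real part.\<close>
  define u where "u = cnj (v /\<^sub>R cmod v)"
  have u: "cmod u = 1" using v(1) by (simp add: u_def)
  have Re_u: "Re (u * x) = (v \<bullet> x) / cmod v" for x
    by (simp add: u_def inner_complex_def field_simps)
  have hS: "h z \<in> S" if "z \<in> ball 0 1" for z
    using sub that by (auto simp: subordinate_def S_def Pi_iff)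
  have "cmod ((if Suc n = 0 then u * p else 0) - u * a (Suc n))
      \<le> 2 * Re ((if (0::nat) = 0 then u * p else 0) - u * a 0)"
  proof (rule Caratheodory_coeff)
    show "(\<lambda>n. ((if n = 0 then u * p else 0) - u * a n) * z ^ n) sums (u * p - u * h z)"
      if "z \<in> ball 0 1" for z
      by (rule power_series_const_minus[OF h[OF that]])
    show "0 \<le> Re (u * p - u * h z)" if "z \<in> ball 0 1" for z
      using v(2)[OF hS[OF that]] v(3) by (simp only: minus_complex.sel Re_u) (simp add: divide_right_mono)
  qed simp
  then have "cmod (a (Suc n)) \<le> 2 * Re (u * (p - a 0))"
    using u by (simp add: norm_mult algebra_simps)
  also have "\<dots> \<le> 2 * cmod (u * (p - a 0))" by (intro mult_left_mono complex_Re_le_cmod) simp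
  also have "a 0 = \<phi> 0" using h[of 0] sub by (auto simp: subordinate_def)
  finally show ?thesis using p(2) u by (simp add: norm_mult dist_norm norm_minus_commute S_def)
qed


text \<open>The majorant of \<open>g\<close> is at most \<open>k\<close> times that of
  \<open>h\<close>, which in turn is dominated by a geometric series with factor \<open>M\<close>;
  the constant is \<open>1 + k = 2 * K / (K + 1)\<close>.\<close>

lemma majorant_sum_le:
  assumes q: "quasiconformal_harmonic K f h g"
    and h: "\<And>z. z \<in> ball 0 1 \<Longrightarrow> (\<lambda>n. a n * z ^ n) sums h z"
    and g: "\<And>z. z \<in> ball 0 1 \<Longrightarrow> (\<lambda>n. b (Suc n) * z ^ Suc n) sums g z"
    and M: "\<And>n. cmod (a (Suc n)) \<le> M"
    and K: "1 \<le> K" and r: "0 \<le> r" "r \<le> 1 / 3"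
  shows "(\<Sum>n. (cmod (a (Suc n)) + cmod (b (Suc n))) * r ^ Suc n) \<le> 2 * K / (K + 1) * (M * r / (1 - r))"
proof -
  define k where "k = (K - 1) / (K + 1)"
  have k: "0 \<le> k" "1 + k = 2 * K / (K + 1)" using K by (auto simp: k_def field_simps)
  \<comment> \<open>The series of \<open>g\<close> starts at index 1; the value 0 at index 0 turns
    it into a full power series without changing later coefficients.\<close>
  define b' where "b' n = (if n = 0 then 0 else b n)" for n
  have g': "(\<lambda>n. b' n * z ^ n) sums g z" if "z \<in> ball 0 1" for z
    using g[OF that] sums_Suc_iff[of "\<lambda>n. b' n * z ^ n" "g z"] by (simp add: b'_def)
  have hol: "h holomorphic_on ball 0 1" "g holomorphic_on ball 0 1"
    and ne: "\<And>z. z \<in> ball 0 1 \<Longrightarrow> deriv h z \<noteq> 0"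
    and w: "\<And>z. z \<in> ball 0 1 \<Longrightarrow> cmod (dilatation h g z) \<le> k"
    using q by (auto simp: quasiconformal_harmonic_def harmonic_decomposition_def sense_preserving_def k_def)
  have dil: "dilatation h g holomorphic_on ball 0 1"
    unfolding dilatation_def[abs_def] using hol ne by (intro holomorphic_intros) auto
  then have "(\<Sum>n. cmod (b' (Suc n)) * r ^ Suc n) \<le> k * (\<Sum>n. cmod (a (Suc n)) * r ^ Suc n)"
    using ne by (intro sum_coeff_le_of_deriv_le[OF h g' dil w _ r]) (simp_all add: dilatation_def)
  then have ba: "(\<Sum>n. cmod (b (Suc n)) * r ^ Suc n) \<le> k * (\<Sum>n. cmod (a (Suc n)) * r ^ Suc n)"
    by (simp add: b'_def)
  have sa: "summable (\<lambda>n. cmod (a (Suc n)) * r ^ Suc n)"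
    using r by (intro summable_Suc_iff[THEN iffD2] power_series_norm_summable[OF h]) auto
  have "summable (\<lambda>n. cmod (b' (Suc n)) * r ^ Suc n)"
    using r by (intro summable_Suc_iff[THEN iffD2] power_series_norm_summable[OF g']) auto
  then have sb: "summable (\<lambda>n. cmod (b (Suc n)) * r ^ Suc n)" by (simp add: b'_def)
  have geo: "(\<lambda>n. M * r * r ^ n) sums (M * r * (1 / (1 - r)))"
    using r by (intro sums_mult geometric_sums) auto
  have aM: "(\<Sum>n. cmod (a (Suc n)) * r ^ Suc n) \<le> M * r / (1 - r)"
  proof -
    have "(\<Sum>n. cmod (a (Suc n)) * r ^ Suc n) \<le> M * r * (1 / (1 - r))"
    proof (rule sums_le[OF _ summable_sums[OF sa] geo])
      show "cmod (a (Suc n)) * r ^ Suc n \<le> M * r * r ^ n" for n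
        using mult_right_mono[OF M[of n], of "r ^ Suc n"] r by (simp add: mult_ac)
    qed
    then show ?thesis by simp
  qed
  have "(\<Sum>n. (cmod (a (Suc n)) + cmod (b (Suc n))) * r ^ Suc n)
      = (\<Sum>n. cmod (a (Suc n)) * r ^ Suc n) + (\<Sum>n. cmod (b (Suc n)) * r ^ Suc n)"
    unfolding distrib_right by (rule suminf_add[OF sa sb, symmetric])
  also have "\<dots> \<le> (1 + k) * (\<Sum>n. cmod (a (Suc n)) * r ^ Suc n)"
    using ba by (simp add: distrib_right)
  also have "\<dots> \<le> (1 + k) * (M * r / (1 - r))"
    using k(1) aM by (intro mult_left_mono) auto
  finally show ?thesis unfolding k(2) .
qed

section \<open>The extremal half-plane map\<close>

text \<open>The inverse map sends \<open>w\<close> to \<open>(w - 1) / w\<close>, and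
  \<open>cmod (w - 1) < cmod w\<close> says that \<open>w\<close> is closer to 1 than to 0.\<close>

lemma halfplane_map_image: "(\<lambda>z. 1 / (1 - z)) ` ball 0 1 = {w. 1 / 2 < Re w}"
proof -
  have *: "cmod (w - 1) < cmod w \<longleftrightarrow> 1 / 2 < Re w" for w
  proof -
    have "cmod (w - 1) < cmod w \<longleftrightarrow> (cmod (w - 1))\<^sup>2 < (cmod w)\<^sup>2"
      using power2_less_imp_less[of "cmod (w - 1)" "cmod w"] power_strict_mono[of "cmod (w - 1)" "cmod w" 2] by auto
    also have "\<dots> \<longleftrightarrow> 1 / 2 < Re w"
      by (simp only: cmod_power2) (simp add: power2_eq_square algebra_simps)
    finally show ?thesis .
  qed
  show ?thesis
  proof (intro equalityI subsetI)
    fix w :: complex assume "w \<in> (\<lambda>z. 1 / (1 - z)) ` ball 0 1"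
    then obtain z where z: "cmod z < 1" "w = 1 / (1 - z)" by auto
    then have "z \<noteq> 1" by auto
    then have "w \<noteq> 0" "w - 1 = z * w" using z by (auto simp: field_simps)
    then have "cmod (w - 1) < cmod w" using z(1) by (simp add: norm_mult)
    then show "w \<in> {w. 1 / 2 < Re w}" by (simp add: *)
  next
    fix w :: complex assume w: "w \<in> {w. 1 / 2 < Re w}"
    then have "w \<noteq> 0" by auto
    moreover have "cmod ((w - 1) / w) < 1"
      using w *[of w] \<open>w \<noteq> 0\<close> by (simp add: norm_divide)
    ultimately show "w \<in> (\<lambda>z. 1 / (1 - z)) ` ball 0 1"
      by (intro image_eqI[of _ _ "(w - 1) / w"]) (auto simp: field_simps)
  qed
qed

text \<open>Testing the inequality on \<open>h z = 1 / (1 - z)\<close>, subordinate to itself, and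
  \<open>g = k (h - 1)\<close>, of constant dilatation \<open>k\<close>, gives a necessary condition
  on \<open>r\<close>. All coefficients of positive index are 1 and \<open>k\<close> respectively,
  so both sums have closed forms.\<close>

lemma extremal_value:
  assumes K: "1 \<le> K" and r: "0 \<le> r" "r < 1" "r \<le> \<rho>" and bohr: "bohr_inequality_upto K \<mu> \<rho>"
  shows "2 * K / (K + 1) * (r / (1 - r)) + \<mu> * (r / (1 - r\<^sup>2)) \<le> 1 / 2"
proof -
  define k where "k = (K - 1) / (K + 1)"
  have k: "0 \<le> k" "k < 1" "1 + k = 2 * K / (K + 1)" using K by (auto simp: k_def field_simps)
  define h :: "complex \<Rightarrow> complex" where "h z = 1 / (1 - z)" for z
  define g where "g z = of_real k * (h z - 1)" for z
  have dh: "(h has_field_derivative 1 / (1 - z)\<^sup>2) (at z)" if "z \<in> ball 0 1" for z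
    unfolding h_def using that by (auto intro!: derivative_eq_intros simp: power2_eq_square)
  have dg: "(g has_field_derivative of_real k * (1 / (1 - z)\<^sup>2)) (at z)" if "z \<in> ball 0 1" for z
    unfolding g_def by (auto intro!: derivative_eq_intros dh[OF that])
  have hol: "h holomorphic_on ball 0 1" "g holomorphic_on ball 0 1"
    using dh dg by (meson field_differentiable_at_within field_differentiable_def holomorphic_on_def)+
  have dil: "deriv h z \<noteq> 0 \<and> dilatation h g z = of_real k" if "z \<in> ball 0 1" for z
    using DERIV_imp_deriv[OF dh[OF that]] DERIV_imp_deriv[OF dg[OF that]] that
    by (auto simp: dilatation_def)
  have q: "quasiconformal_harmonic K (\<lambda>z. h z + cnj (g z)) h g"
    using hol dil k by (auto simp: quasiconformal_harmonic_def harmonic_decomposition_def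
        sense_preserving_def k_def[symmetric])
  have sh: "(\<lambda>n. 1 * z ^ n) sums h z" if "z \<in> ball 0 1" for z
    using geometric_sums[of z] that by (simp add: h_def)
  have sg: "(\<lambda>n. of_real k * z ^ Suc n) sums g z" if "z \<in> ball 0 1" for z
    unfolding g_def using sums_mult[OF sums_split_initial_segment[OF sh[OF that], of 1], of "of_real k"] by simp
  have im: "h ` ball 0 1 = {w. 1 / 2 < Re w}"
    unfolding h_def[abs_def] by (rule halfplane_map_image)
  have uc: "univalent_convex h"
    unfolding univalent_convex_def im
    using hol(1) convex_halfspace_Re_gt[of "1/2"] by (auto simp: inj_on_def h_def)
  have sub: "subordinate h h"
    unfolding subordinate_def by (intro exI[of _ "\<lambda>z. z"]) (auto intro!: holomorphic_intros)
  \<comment> \<open>The distance stands on the larger side of the inequality, so an upper bound from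
    one boundary point suffices.\<close>
  have "(1 / 2 :: complex) \<in> frontier {w. 1 / 2 < Re w}"
    using frontier_halfspace_gt[of "1 :: complex" "1 / 2"] by simp
  then have "infdist (h 0) (frontier (h ` ball 0 1)) \<le> dist (h 0) (1 / 2)"
    unfolding im by (rule infdist_le)
  also have "\<dots> = 1 / 2" by (simp add: h_def dist_norm)
  finally have d: "infdist (h 0) (frontier (h ` ball 0 1)) \<le> 1 / 2" .
  have "(\<lambda>n. (1 + k) * r * r ^ n) sums ((1 + k) * r * (1 / (1 - r)))"
    using r by (intro sums_mult geometric_sums) auto
  then have s: "(\<Sum>n. (cmod 1 + cmod (of_real k)) * r ^ Suc n) = (1 + k) * (r / (1 - r))"
    using k(1) by (simp add: sums_iff mult.assoc)
  have ar: "sqrt (area_integral h r / pi) = r / (1 - r\<^sup>2)"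
    using area_integral_geometric_le(2)[OF sh r(1,2), of 1] by simp
  have "(\<Sum>n. (cmod 1 + cmod (of_real k)) * r ^ Suc n) + \<mu> * sqrt (area_integral h r / pi)
      \<le> infdist (h 0) (frontier (h ` ball 0 1))"
    using bohr[unfolded bohr_inequality_upto_def, rule_format,
        of "\<lambda>z. h z + cnj (g z)" h g "\<lambda>n. 1" "\<lambda>n. of_real k" h r] q sh sg uc sub r by simp
  from order_trans[OF this d] show ?thesis unfolding s ar k(3) .
qed

section \<open>The radius as the root of the quadratic\<close>

theorem theorem4p2:
  fixes K \<mu> :: real
  assumes "K \<ge> 1" and "\<mu> \<ge> 0"
  shows "\<exists>r0. 0 < r0 \<and> r0 < 1 \<and>
           (\<forall>r>0. (5 * K + 1) / (K + 1) * r\<^sup>2 + 2 * (\<mu> + 2 * K / (K + 1)) * r - 1 = 0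
                    \<longleftrightarrow> r = r0) \<and>
           bohr_inequality_upto K \<mu> r0 \<and>
           (\<forall>\<rho>>r0. \<not> bohr_inequality_upto K \<mu> \<rho>)"
proof -
  define A where "A = (5 * K + 1) / (K + 1)"
  define L where "L = 2 * K / (K + 1)"
  define p where "p r = A * r\<^sup>2 + 2 * (\<mu> + L) * r - 1" for r
  \<comment> \<open>The relation between \<open>A\<close> and \<open>L\<close> is what makes the
    summed estimates collapse to the quadratic \<open>p\<close> in \<open>key\<close>.\<close>
  have A: "3 \<le> A" "A = 1 + 2 * L" and L: "1 \<le> L"
    using assms by (auto simp: A_def L_def field_simps)
  have mono: "p s < p t" if "0 \<le> s" "s < t" for s t
  proof -
    have "A * s\<^sup>2 \<le> A * t\<^sup>2" using that A by (intro mult_left_mono power_mono) auto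
    moreover have "2 * (\<mu> + L) * s < 2 * (\<mu> + L) * t" using that L assms by simp
    ultimately show ?thesis by (simp add: p_def)
  qed
  have "p 0 \<le> 0" by (simp add: p_def)
  \<comment> \<open>Since \<open>A \<ge> 3\<close>, \<open>L \<ge> 1\<close> and
    \<open>\<mu> \<ge> 0\<close>, the value is at least \<open>1/3 + 2/3 - 1\<close>. This places
    the root at most at 1/3, within the range of Bohr's inequality.\<close>
  moreover have "0 \<le> p (1 / 3)" using A L assms by (simp add: p_def power2_eq_square field_simps)
  moreover have "continuous_on {0..1 / 3} p" unfolding p_def by (intro continuous_intros)
  ultimately obtain r0 where r0: "0 \<le> r0" "r0 \<le> 1 / 3" "p r0 = 0"
    using IVT'[of p 0 0 "1 / 3"] by auto
  have "r0 \<noteq> 0" using r0(3) by (auto simp: p_def)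
  \<comment> \<open>The left side is the total bound in units of the distance; it exceeds 1 exactly
    when \<open>p r > 0\<close>. The same identity therefore gives both the inequality and its
    sharpness.\<close>
  have key: "2 * (L * (r / (1 - r)) + \<mu> * (r / (1 - r\<^sup>2))) = 1 + p r / (1 - r\<^sup>2)"
    if "0 \<le> r" "r < 1" for r
  proof -
    have "1 - r\<^sup>2 = (1 - r) * (1 + r)" by (simp add: power2_eq_square algebra_simps)
    moreover have "1 - r \<noteq> 0" "1 + r \<noteq> 0" using that by auto
    ultimately show ?thesis
      unfolding p_def A(2) by (simp add: divide_simps) (simp add: algebra_simps power2_eq_square)
  qed
  have "bohr_inequality_upto K \<mu> r0"
    unfolding bohr_inequality_upto_def
  proof (intro allI impI)
    fix f h g \<phi> :: "complex \<Rightarrow> complex" and a b :: "nat \<Rightarrow> complex" and r :: real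
    assume q: "quasiconformal_harmonic K f h g"
      and h: "\<forall>z\<in>ball 0 1. (\<lambda>n. a n * z ^ n) sums h z"
      and g: "\<forall>z\<in>ball 0 1. (\<lambda>n. b (Suc n) * z ^ Suc n) sums g z"
      and uc: "univalent_convex \<phi>" and sub: "subordinate h \<phi>"
      and r: "0 \<le> r" "r < 1" "r \<le> r0"
    define d where "d = infdist (\<phi> 0) (frontier (\<phi> ` ball 0 1))"
    have a: "cmod (a (Suc n)) \<le> 2 * d" for n
      unfolding d_def by (rule subordinate_convex_coeff_le[OF uc sub]) (use h in auto)
    have "(\<Sum>n. (cmod (a (Suc n)) + cmod (b (Suc n))) * r ^ Suc n) \<le> L * (2 * d * r / (1 - r))"
      unfolding L_def using q h g a assms r r0 by (intro majorant_sum_le) auto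
    moreover have "\<mu> * sqrt (area_integral h r / pi) \<le> \<mu> * (2 * d * r / (1 - r\<^sup>2))"
      using h a r assms by (intro mult_left_mono area_integral_geometric_le(1)) auto
    ultimately have "(\<Sum>n. (cmod (a (Suc n)) + cmod (b (Suc n))) * r ^ Suc n) + \<mu> * sqrt (area_integral h r / pi)
        \<le> d * (2 * (L * (r / (1 - r)) + \<mu> * (r / (1 - r\<^sup>2))))"
      by (simp add: algebra_simps)
    also have "\<dots> = d * (1 + p r / (1 - r\<^sup>2))" by (simp only: key[OF r(1,2)])
    also have "\<dots> \<le> d * 1"
    proof (intro mult_left_mono)
      have "p r \<le> 0" using mono[of r r0] r r0 by (cases "r = r0") auto
      moreover have "0 < 1 - r\<^sup>2" using r by (simp add: power_less_one_iff)
      ultimately show "1 + p r / (1 - r\<^sup>2) \<le> 1" by (simp add: divide_nonpos_pos)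
      show "0 \<le> d" by (simp add: d_def infdist_nonneg)
    qed
    finally show "(\<Sum>n. (cmod (a (Suc n)) + cmod (b (Suc n))) * r ^ Suc n) + \<mu> * sqrt (area_integral h r / pi)
        \<le> infdist (\<phi> 0) (frontier (\<phi> ` ball 0 1))"
      by (simp add: d_def)
  qed
  moreover have "\<not> bohr_inequality_upto K \<mu> \<rho>" if "r0 < \<rho>" for \<rho>
  proof
    assume bohr: "bohr_inequality_upto K \<mu> \<rho>"
    \<comment> \<open>The test radius must stay below 1 even if \<open>\<rho>\<close> does
      not.\<close>
    obtain r where r: "r0 < r" "r < min \<rho> 1"
      using dense[of r0 "min \<rho> 1"] \<open>r0 < \<rho>\<close> r0 by auto
    have "2 * (L * (r / (1 - r)) + \<mu> * (r / (1 - r\<^sup>2))) \<le> 2 * (1 / 2)"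
      unfolding L_def using r r0 by (intro mult_left_mono extremal_value[OF assms(1) _ _ _ bohr]) auto
    then have "1 + p r / (1 - r\<^sup>2) \<le> 2 * (1 / 2)"
      using r r0 by (subst (asm) key) auto
    moreover have "0 < p r / (1 - r\<^sup>2)"
      using mono[of r0 r] r r0 by (simp add: power_less_one_iff)
    ultimately show False by simp
  qed
  moreover have "p r = 0 \<longleftrightarrow> r = r0" if "0 < r" for r
    using mono[of r r0] mono[of r0 r] that r0 by (cases r r0 rule: linorder_cases) auto
  ultimately show ?thesis
    using r0 \<open>r0 \<noteq> 0\<close> unfolding p_def A_def L_def by (intro exI[of _ r0]) auto
qed

end
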